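(* Let $m,n\ge1$, let $p=(p_{ij})_{1\le i,j\le mn}$, $q=(q_{ij})_{1\le i,j\le mn}$ satisfy the $(p,\lambda)$ condition, and let $R$ be a unital associative $\mathbb C$-algebra. Let $A=(a_{ij})_{1\le i,j\le mn}$ be a $(p,\lambda)$-matrix with entries in $R$, and let $B=(b_{i_1\cdots i_m})_{1\le i_1,\dots,i_m\le mn}$ be any hypermatrix with (not necessarily commuting) entries in $R$, each of which commutes with every entry of $A$. For $I=(i_1<\cdots<i_m)$ in $\{1,\dots,mn\}$ let $$c_I=\sum_{J}{\det}_q(A^J_I)\,b_J,$$ where $J=(j_1<\cdots<j_m)$ runs over the $m$-element subsets of $\{1,\dots,mn\}$ and $b_J=b_{j_1\cdots j_m}$, and let $C=(c_I)$. Then $$\mathrm{Pf}_q(C)={\det}_q(A)\,\mathrm{Pf}_q(B).$$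
   Context: Parameters: $p$ and $q$ are $mn\times mn$ matrices of complex numbers with $p_{ij}p_{ji}=1$, $p_{ii}=1$, $q_{ij}q_{ji}=1$, $q_{ii}=1$. The $(p,\lambda)$ condition: there is $\lambda\in\mathbb C$, $\lambda\ne -1$, with $p_{ij}q_{ij}=\lambda$ for all $i<j$. A $(p,\lambda)$-matrix is a matrix $A=(a_{ij})$ whose entries satisfy $$a_{ik}a_{il}=q_{kl}a_{il}a_{ik}\quad (k<l,\ \text{all } i),$$ $$a_{ik}a_{jk}=p_{ij}a_{jk}a_{ik}\quad (i<j,\ \text{all } k),$$ and, for $i<j$ and $k<l$, $$a_{ik}a_{jl}-\frac{q_{kl}}{q_{ij}}a_{jl}a_{ik}=q_{kl}a_{il}a_{jk}-\frac{1}{q_{ij}}a_{jk}a_{il},$$ $$a_{ik}a_{jl}-\frac{p_{ij}}{p_{kl}}a_{jl}a_{ik}=p_{ij}a_{jk}a_{il}-\frac{1}{p_{kl}}a_{il}a_{jk}.$$ Minors and determinant: for $J=(j_1<\cdots<j_t)$ and $I=(i_1<\cdots<i_t)$, $A^J_I$ is the submatrix of $A$ with rows $J$ and columns $I$, and $${\det}_q(A^J_I)=\sum_{\sigma\in S_t}(-1)^{l(\sigma)}\Big(\prod_{a<b,\ \sigma_a>\sigma_b}q_{i_{\sigma_b}i_{\sigma_a}}\Big)a_{j_1,i_{\sigma_1}}\cdots a_{j_t,i_{\sigma_t}},$$ where $l(\sigma)$ is the number of inversions of $\sigma$. ${\det}_q(A)$ is the case $I=J=(1,\dots,mn)$. (Under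 the $(p,\lambda)$ condition this equals the column version $\sum_{\sigma}(-1)^{l(\sigma)}\big(\prod_{a<b,\ \sigma_a>\sigma_b}p_{j_{\sigma_b}j_{\sigma_a}}\big)a_{j_{\sigma_1},i_1}\cdots a_{j_{\sigma_t},i_t}$.) For $\sigma\in S_{mn}$ put $(-q)_\sigma=(-1)^{l(\sigma)}\prod_{i<j,\ \sigma_i>\sigma_j}q_{\sigma_j\sigma_i}$. The multiparameter quantum hyper-Pfaffian of a hypermatrix $B=(b_{i_1\cdots i_m})$, $1\le i_k\le mn$, is $$\mathrm{Pf}_q(B)=\sum_{\sigma\in\Pi}(-q)_\sigma\, b_{\sigma(1)\cdots\sigma(m)}\,b_{\sigma(m+1)\cdots\sigma(2m)}\cdots b_{\sigma(m(n-1)+1)\cdots\sigma(mn)},$$ where $\Pi$ is the set of $\sigma\in S_{mn}$ with $\sigma((k-1)m+1)<\sigma((k-1)m+2)<\cdots<\sigma(km)$ for $k=1,\dots,n$. Only the entries with $i_1<\cdots<i_m$ occur, so $\mathrm{Pf}_q(C)$ depends only on the $c_I$ with $I$ increasing. *)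

theory Defs
  imports "HOL-Combinatorics.Permutations" Complex_Main
begin

text \<open>
  Unital associative algebras over the complex numbers, not assumed commutative. In contrast to
  the library class of real algebras with unit, the zero algebra is not excluded.
\<close>

class complex_unital_algebra = ring + monoid_mult +
  fixes scaleC :: "complex \<Rightarrow> 'a \<Rightarrow> 'a"  (infixr "*\<^sub>C" 75)
  assumes scaleC_add_right: "c *\<^sub>C (x + y) = c *\<^sub>C x + c *\<^sub>C y"
    and scaleC_add_left: "(c + d) *\<^sub>C x = c *\<^sub>C x + d *\<^sub>C x"
    and scaleC_scaleC: "c *\<^sub>C d *\<^sub>C x = (c * d) *\<^sub>C x"
    and scaleC_one: "1 *\<^sub>C x = x"
    and mult_scaleC_left: "(c *\<^sub>C x) * y = c *\<^sub>C (x * y)"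
    and mult_scaleC_right: "x * (c *\<^sub>C y) = c *\<^sub>C (x * y)"

text \<open>
  All indices start at \<open>0\<close>: the index set \<open>{1, \<dots>, N}\<close> of the mathematical text is rendered as
  \<open>{..<N}\<close>. Matrices are functions of which only the values at indices below \<open>N\<close> are relevant, and
  an entry of a hypermatrix is addressed by the list of its indices.
\<close>

definition pl_condition ::
    "nat \<Rightarrow> (nat \<Rightarrow> nat \<Rightarrow> complex) \<Rightarrow> (nat \<Rightarrow> nat \<Rightarrow> complex) \<Rightarrow> bool" where
  "pl_condition N p q \<longleftrightarrow>
     (\<forall>i<N. \<forall>j<N. p i j * p j i = 1 \<and> q i j * q j i = 1) \<and>
     (\<forall>i<N. p i i = 1 \<and> q i i = 1) \<and>
     (\<exists>lam. lam \<noteq> -1 \<and> (\<forall>i j. i < j \<and> j < N \<longrightarrow> p i j * q i j = lam))"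

definition pl_matrix ::
    "nat \<Rightarrow> (nat \<Rightarrow> nat \<Rightarrow> complex) \<Rightarrow> (nat \<Rightarrow> nat \<Rightarrow> complex) \<Rightarrow>
     (nat \<Rightarrow> nat \<Rightarrow> 'a::complex_unital_algebra) \<Rightarrow> bool" where
  "pl_matrix N p q a \<longleftrightarrow>
     (\<forall>i k l. i < N \<and> k < l \<and> l < N \<longrightarrow> a i k * a i l = q k l *\<^sub>C (a i l * a i k)) \<and>
     (\<forall>i j k. i < j \<and> j < N \<and> k < N \<longrightarrow> a i k * a j k = p i j *\<^sub>C (a j k * a i k)) \<and>
     (\<forall>i j k l. i < j \<and> j < N \<and> k < l \<and> l < N \<longrightarrow>
        a i k * a j l - (q k l / q i j) *\<^sub>C (a j l * a i k) =
          q k l *\<^sub>C (a i l * a j k) - (1 / q i j) *\<^sub>C (a j k * a i l) \<and>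
        a i k * a j l - (p i j / p k l) *\<^sub>C (a j l * a i k) =
          p i j *\<^sub>C (a j k * a i l) - (1 / p k l) *\<^sub>C (a i l * a j k))"

definition inversions :: "nat \<Rightarrow> (nat \<Rightarrow> nat) \<Rightarrow> (nat \<times> nat) set" where
  "inversions t \<sigma> = {(a, b). a < b \<and> b < t \<and> \<sigma> a > \<sigma> b}"

text \<open>The coefficient \<open>(-q)\<^sub>\<sigma>\<close> of a permutation \<open>\<sigma>\<close> of \<open>{..<t}\<close>.\<close>

definition neg_q :: "nat \<Rightarrow> (nat \<Rightarrow> nat \<Rightarrow> complex) \<Rightarrow> (nat \<Rightarrow> nat) \<Rightarrow> complex" where
  "neg_q t q \<sigma> =
     (-1) ^ card (inversions t \<sigma>) * (\<Prod>(a, b)\<in>inversions t \<sigma>. q (\<sigma> b) (\<sigma> a))"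

definition increasing_tuples :: "nat \<Rightarrow> nat \<Rightarrow> nat list set" where
  "increasing_tuples t N = {J. length J = t \<and> sorted_wrt (<) J \<and> set J \<subseteq> {..<N}}"

text \<open>
  The quantum minor of \<open>a\<close> with rows \<open>J\<close> and columns \<open>I\<close>. The row index \<open>J ! k\<close> and the column index
  \<open>I ! \<sigma> k\<close> belong to the \<open>k\<close>-th factor; the order of the factors matters, hence \<open>prod_list\<close>.
\<close>

definition q_minor ::
    "(nat \<Rightarrow> nat \<Rightarrow> complex) \<Rightarrow> (nat \<Rightarrow> nat \<Rightarrow> 'a::complex_unital_algebra) \<Rightarrow>
     nat list \<Rightarrow> nat list \<Rightarrow> 'a" where
  "q_minor q a J I =
     (\<Sum>\<sigma> | \<sigma> permutes {..<length I}.
        neg_q (length I) (\<lambda>r s. q (I ! r) (I ! s)) \<sigma> *\<^sub>C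
          prod_list (map (\<lambda>k. a (J ! k) (I ! \<sigma> k)) [0..<length I]))"

definition q_det ::
    "nat \<Rightarrow> (nat \<Rightarrow> nat \<Rightarrow> complex) \<Rightarrow> (nat \<Rightarrow> nat \<Rightarrow> 'a::complex_unital_algebra) \<Rightarrow> 'a" where
  "q_det N q a = q_minor q a [0..<N] [0..<N]"

definition block_increasing_perms :: "nat \<Rightarrow> nat \<Rightarrow> (nat \<Rightarrow> nat) set" where
  "block_increasing_perms m n =
     {\<sigma>. \<sigma> permutes {..<m * n} \<and> (\<forall>k<n. strict_mono_on {k * m..<Suc k * m} \<sigma>)}"

definition q_hyper_pfaffian ::
    "nat \<Rightarrow> nat \<Rightarrow> (nat \<Rightarrow> nat \<Rightarrow> complex) \<Rightarrow>
     (nat list \<Rightarrow> 'a::complex_unital_algebra) \<Rightarrow> 'a" where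
  "q_hyper_pfaffian m n q b =
     (\<Sum>\<sigma>\<in>block_increasing_perms m n.
        neg_q (m * n) q \<sigma> *\<^sub>C
          prod_list (map (\<lambda>k. b (map \<sigma> [k * m..<Suc k * m])) [0..<n]))"

end

theory Submission
  imports Defs
begin

text \<open>
  Everything is written as a sum over words \<open>s\<close> in the alphabet \<open>{..<N}\<close>, \<open>N = m n\<close>, weighted by a
  coefficient \<open>word_coeff q s\<close> that is \<open>(-q)\<^sub>\<sigma>\<close> if \<open>s\<close> lists the values of a permutation \<open>\<sigma>\<close> and \<open>0\<close> if \<open>s\<close>
  repeats a letter. It is the coefficient that appears when a monomial in generators
  \<open>x\<^sub>0, \<dots>, x\<^sub>N\<^sub>-\<^sub>1\<close> of a quantum exterior algebra, with \<open>x\<^sub>i x\<^sub>i = 0\<close> and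
  \<open>x\<^sub>j x\<^sub>i = - q i j x\<^sub>i x\<^sub>j\<close> for \<open>i < j\<close>, is put into increasing order; the words replace that
  algebra here. Because of the zeros no sum has to be restricted to permutations.

  For a word \<open>r\<close> of rows let \<open>D r\<close> (\<open>row_det\<close>) be the sum over all words \<open>s\<close> of \<open>word_coeff q s\<close> times
  the product of the entries \<open>a (r ! k) (s ! k)\<close>. Two facts carry the proof.

  First, \<open>D r = word_coeff q r \<cdot> det\<^sub>q A\<close> for every word \<open>r\<close> of length \<open>N\<close> (\<open>row_det_eq\<close>). Both sides
  change in the same way when two neighbouring letters of \<open>r\<close> are exchanged. For \<open>D\<close> this is where the
  relations between the entries of \<open>A\<close> enter (\<open>row_det_swap\<close>): group the words \<open>s\<close> that differ by exchanging
  the letters \<open>k < l\<close> at the two positions. If the rows are \<open>y < x\<close>, the factor to be compared is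
  \<open>a x k a y l - q k l a x l a y k\<close>, which by the cross relation is \<open>- q y x\<close> times the same expression with
  \<open>x\<close> and \<open>y\<close> exchanged. If the rows are equal, it vanishes by the relation within a row. So \<open>D\<close> can be
  sorted like \<open>word_coeff\<close> (\<open>alternating_sort\<close>).

  Second, there is a Laplace expansion along blocks of rows (\<open>laplace_expansion\<close>): for rows
  \<open>J\<^sub>1, \<dots>, J\<^sub>n\<close>, grouping the words by the sorted contents \<open>I\<^sub>1, \<dots>, I\<^sub>n\<close> of their blocks gives
  \<open>D (J\<^sub>1 \<dots> J\<^sub>n)\<close> as the sum of \<open>word_coeff q (I\<^sub>1 \<dots> I\<^sub>n)\<close> times the product of the minors
  \<open>det\<^sub>q A\<^sup>J\<^sub>I\<close>, since the coefficient of a word is the product of the coefficients of its blocks and the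
  coefficient of the word with sorted blocks.

  Now expand \<open>Pf\<^sub>q C\<close>, collect the entries of \<open>B\<close> on the right, and sum over the columns
  \<open>I\<^sub>1, \<dots>, I\<^sub>n\<close> first. The expansion turns this inner sum into \<open>D (J\<^sub>1 \<dots> J\<^sub>n)\<close>, hence into
  \<open>word_coeff q (J\<^sub>1 \<dots> J\<^sub>n) \<cdot> det\<^sub>q A\<close>, and what remains of the sum is \<open>Pf\<^sub>q B\<close>.
\<close>

section \<open>Scalar multiplication\<close>

lemma scaleC_zero_right [simp]: "c *\<^sub>C (0 :: 'a::complex_unital_algebra) = 0"
  using scaleC_add_right[of c "0::'a" 0] by simp

lemma scaleC_zero_left [simp]: "0 *\<^sub>C (x :: 'a::complex_unital_algebra) = 0"
  using scaleC_add_left[of 0 0 x] by simp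

lemma scaleC_minus_left: "(- c) *\<^sub>C (x :: 'a::complex_unital_algebra) = - (c *\<^sub>C x)"
  using scaleC_add_left[of "- c" c x] by (simp add: eq_neg_iff_add_eq_0)

lemma scaleC_minus_right: "c *\<^sub>C (- x :: 'a::complex_unital_algebra) = - (c *\<^sub>C x)"
  using scaleC_add_right[of c "- x" x] by (simp add: eq_neg_iff_add_eq_0)

lemma scaleC_diff_right:
  "c *\<^sub>C (x - y :: 'a::complex_unital_algebra) = c *\<^sub>C x - c *\<^sub>C y"
  using scaleC_add_right[of c x "- y"] by (simp add: scaleC_minus_right)

lemma scaleC_sum_right:
  "c *\<^sub>C (\<Sum>x\<in>S. f x :: 'a::complex_unital_algebra) = (\<Sum>x\<in>S. c *\<^sub>C f x)"
  by (induction S rule: infinite_finite_induct) (simp_all add: scaleC_add_right)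

section \<open>Sums over words\<close>

definition words :: "'b set \<Rightarrow> nat \<Rightarrow> 'b list set" where
  "words X n = {s. set s \<subseteq> X \<and> length s = n}"

lemma finite_words [simp]: "finite X \<Longrightarrow> finite (words X n)"
  unfolding words_def by (rule finite_lists_length_eq)

lemma words_0 [simp]: "words X 0 = {[]}"
  by (auto simp: words_def)

lemma sum_words_append:
  "sum f (words X (k + l)) = (\<Sum>s\<in>words X k. \<Sum>t\<in>words X l. f (s @ t))"
proof -
  have "(\<Sum>s\<in>words X k. \<Sum>t\<in>words X l. f (s @ t)) =
      (\<Sum>(s, t)\<in>words X k \<times> words X l. f (s @ t))"
    by (rule sum.cartesian_product)
  also have "\<dots> = sum f (words X (k + l))"
    by (rule sum.reindex_bij_witness
        [where i = "\<lambda>s. (take k s, drop k s)" and j = "\<lambda>(s, t). s @ t"])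
      (auto simp: words_def dest: in_set_takeD in_set_dropD)
  finally show ?thesis by simp
qed

lemma sum_words_Suc:
  "sum f (words X (Suc l)) = (\<Sum>x\<in>X. \<Sum>t\<in>words X l. f (x # t))"
proof -
  have "sum g (words X 1) = (\<Sum>x\<in>X. g [x])" for g :: "'b list \<Rightarrow> 'a"
    by (rule sum.reindex_bij_witness[where i = "\<lambda>x. [x]" and j = hd])
      (auto simp: words_def length_Suc_conv)
  then show ?thesis
    using sum_words_append[of f X 1 l] by simp
qed

lemma prod_list_sum:
  fixes f :: "'b \<Rightarrow> 'c \<Rightarrow> 'a::complex_unital_algebra"
  shows "prod_list (map (\<lambda>i. \<Sum>j\<in>X. f j i) is) =
    (\<Sum>js\<in>words X (length is). prod_list (map2 f js is))"
proof (induction "is")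
  case (Cons i "is")
  then show ?case
    by (simp add: sum_words_Suc sum_product)
qed simp

text \<open>
  The index square is the diagonal together with the pairs \<open>{(k, l), (l, k)}\<close>, and the hypotheses compare
  the two sums on each of these parts.
\<close>

lemma sum_symmetrize:
  fixes f h :: "nat \<Rightarrow> nat \<Rightarrow> 'a::ab_group_add"
  assumes "\<And>k. k < N \<Longrightarrow> f k k = h k k"
    and "\<And>k l. k < l \<Longrightarrow> l < N \<Longrightarrow> f k l + f l k = h k l + h l k"
  shows "(\<Sum>k<N. \<Sum>l<N. f k l) = (\<Sum>k<N. \<Sum>l<N. h k l)"
  using assms
proof (induction N)
  case (Suc N)
  have split: "(\<Sum>k<Suc N. \<Sum>l<Suc N. g k l) =
      (\<Sum>k<N. \<Sum>l<N. g k l) + (\<Sum>k<N. g k N + g N k) + g N N"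
    for g :: "nat \<Rightarrow> nat \<Rightarrow> 'a"
    by (simp add: sum.distrib algebra_simps)
  have "(\<Sum>k<N. f k N + f N k) = (\<Sum>k<N. h k N + h N k)"
    using Suc.prems(2) by (intro sum.cong) auto
  moreover have "(\<Sum>k<N. \<Sum>l<N. f k l) = (\<Sum>k<N. \<Sum>l<N. h k l)"
    using Suc.prems by (intro Suc.IH) auto
  ultimately show ?case
    unfolding split using Suc.prems(1)[of N] by simp
qed simp

section \<open>The coefficient of a word\<close>

text \<open>
  Contribution of a letter \<open>x\<close> standing somewhere to the left of a letter \<open>y\<close>. The value \<open>0\<close> for equal
  letters makes \<open>word_coeff\<close> vanish on words with repetitions.
\<close>

definition pair_coeff :: "(nat \<Rightarrow> nat \<Rightarrow> complex) \<Rightarrow> nat \<Rightarrow> nat \<Rightarrow> complex" where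
  "pair_coeff q x y = (if y < x then - q y x else if y = x then 0 else 1)"

fun word_coeff :: "(nat \<Rightarrow> nat \<Rightarrow> complex) \<Rightarrow> nat list \<Rightarrow> complex" where
  "word_coeff q [] = 1"
| "word_coeff q (x # s) = prod_list (map (pair_coeff q x) s) * word_coeff q s"

lemma word_coeff_eq_0: "\<not> distinct s \<Longrightarrow> word_coeff q s = 0"
proof (induction s)
  case (Cons x s)
  then show ?case
    by (force simp: prod_list_zero_iff pair_coeff_def)
qed simp

lemma word_coeff_swap:
  assumes "y \<le> x"
  shows "word_coeff q (us @ x # y # vs) = pair_coeff q x y * word_coeff q (us @ y # x # vs)"
proof (induction us)
  case Nil
  then show ?case
    using assms by (cases "x = y") (auto simp: pair_coeff_def)
next
  case (Cons u us)
  then show ?case by (simp add: mult_ac)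
qed

lemma word_coeff_prod:
  "word_coeff q s = (\<Prod>b<length s. \<Prod>a<b. pair_coeff q (s ! a) (s ! b))"
proof (induction s)
  case (Cons x s)
  have "prod_list (map (pair_coeff q x) s) = (\<Prod>b<length s. pair_coeff q x (s ! b))"
    by (simp add: prod.list_conv_set_nth atLeast0LessThan)
  then show ?case
    by (simp add: Cons.IH prod.lessThan_Suc_shift prod.distrib del: prod.lessThan_Suc)
qed simp

text \<open>
  As \<open>I\<close> is increasing, the inversions of \<open>\<sigma>\<close> are the pairs of positions at which the letters of the
  permuted word are in decreasing order; all other pairs contribute \<open>1\<close>, since no letter is repeated.
\<close>

lemma neg_q_eq_word_coeff:
  assumes "\<sigma> permutes {..<length I}" and "sorted_wrt (<) I"
  shows "neg_q (length I) (\<lambda>r s. q (I ! r) (I ! s)) \<sigma> =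
    word_coeff q (permute_list \<sigma> I)"
proof -
  let ?t = "length I"
  let ?T = "SIGMA b:{..<?t}. {..<b}"
  have less: "I ! \<sigma> b < I ! \<sigma> a \<longleftrightarrow> \<sigma> b < \<sigma> a"
    and eq: "I ! \<sigma> b = I ! \<sigma> a \<longleftrightarrow> b = a" if "a < ?t" "b < ?t" for a b
  proof -
    have ab: "\<sigma> a < ?t" "\<sigma> b < ?t"
      using that permutes_in_image[OF assms(1)] by auto
    have mono: "I ! i < I ! j" if "i < j" "j < ?t" for i j
      using assms(2) that by (simp add: sorted_wrt_iff_nth_less)
    have inj: "\<sigma> b = \<sigma> a \<longleftrightarrow> b = a"
      using permutes_inj[OF assms(1)] by (auto dest: injD)
    show "I ! \<sigma> b < I ! \<sigma> a \<longleftrightarrow> \<sigma> b < \<sigma> a" "I ! \<sigma> b = I ! \<sigma> a \<longleftrightarrow> b = a"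
      using mono[of "\<sigma> a" "\<sigma> b"] mono[of "\<sigma> b" "\<sigma> a"] ab inj
      by (cases "\<sigma> a" "\<sigma> b" rule: linorder_cases; force)+
  qed
  have "neg_q ?t (\<lambda>r s. q (I ! r) (I ! s)) \<sigma> =
      (\<Prod>(a, b)\<in>inversions ?t \<sigma>. - q (I ! \<sigma> b) (I ! \<sigma> a))"
    by (simp add: neg_q_def prod.distrib[symmetric] case_prod_unfold prod_constant[symmetric]
        del: prod_constant)
  also have "\<dots> = (\<Prod>(b, a)\<in>{x \<in> ?T. \<sigma> (fst x) < \<sigma> (snd x)}. - q (I ! \<sigma> b) (I ! \<sigma> a))"
    by (rule prod.reindex_bij_witness[where i = prod.swap and j = prod.swap])
      (auto simp: inversions_def)
  also have "\<dots> = (\<Prod>(b, a)\<in>?T. if \<sigma> b < \<sigma> a then - q (I ! \<sigma> b) (I ! \<sigma> a) else 1)"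
    by (subst prod.inter_filter) (auto simp: case_prod_unfold intro!: prod.cong)
  also have "\<dots> = (\<Prod>(b, a)\<in>?T. pair_coeff q (I ! \<sigma> a) (I ! \<sigma> b))"
    by (rule prod.cong) (auto simp: pair_coeff_def less eq)
  also have "\<dots> = (\<Prod>b<?t. \<Prod>a<b. pair_coeff q (I ! \<sigma> a) (I ! \<sigma> b))"
    by (subst prod.Sigma) auto
  also have "\<dots> = word_coeff q (permute_list \<sigma> I)"
    unfolding word_coeff_prod by (intro prod.cong) (auto simp: permute_list_nth[OF assms(1)])
  finally show ?thesis .
qed

text \<open>
  Insertion sort: each exchange of neighbours needed to sort \<open>r\<close> costs exactly the factor that the pair
  contributes to \<open>word_coeff q r\<close>. Exchanging two equal letters leaves the word unchanged and yields the
  factor \<open>0\<close>, so words with repetitions need no separate treatment. The scalar action is a parameter because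
  the lemma is used for \<open>word_coeff\<close> itself, with values in the complex numbers, and for \<open>row_det\<close>, with
  values in the algebra.
\<close>

lemma alternating_sort:
  fixes smul :: "complex \<Rightarrow> 'b \<Rightarrow> 'b" and f :: "nat list \<Rightarrow> 'b"
  assumes smul_one: "\<And>v. smul 1 v = v"
    and smul_smul: "\<And>c d v. smul c (smul d v) = smul (c * d) v"
    and swap: "\<And>us x y vs. y \<le> x \<Longrightarrow> set (us @ x # y # vs) \<subseteq> X \<Longrightarrow>
      f (us @ x # y # vs) = smul (pair_coeff q x y) (f (us @ y # x # vs))"
    and "set (us @ r @ vs) \<subseteq> X"
  shows "f (us @ r @ vs) = smul (word_coeff q r) (f (us @ sort r @ vs))"
  using assms(4)
proof (induction r arbitrary: us)
  case Nil
  then show ?case by (simp add: smul_one)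
next
  case (Cons x r)
  have insert: "f (us @ x # ys @ vs) =
      smul (prod_list (map (pair_coeff q x) ys)) (f (us @ insort x ys @ vs))"
    if "sorted ys" "set (us @ x # ys @ vs) \<subseteq> X" for us ys
    using that
  proof (induction ys arbitrary: us)
    case Nil
    then show ?case by (simp add: smul_one)
  next
    case (Cons y ys)
    consider "x < y" | "x = y" | "y < x" by linarith
    then show ?case
    proof cases
      case 1
      have "map (pair_coeff q x) (y # ys) = map (\<lambda>_. 1) (y # ys)"
        using 1 Cons.prems(1) by (intro map_cong) (auto simp: pair_coeff_def)
      then have "prod_list (map (pair_coeff q x) (y # ys)) = prod_list (map (\<lambda>_. 1) (y # ys))"
        by (rule arg_cong)
      then show ?thesis
        using 1 by (simp add: smul_one map_replicate_const)
    next
      case 2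
      \<comment> \<open>Inserting \<open>x\<close> in front of an equal letter changes nothing; \<open>swap\<close> still supplies a factor \<open>0\<close>.\<close>
      then show ?thesis
        using swap[of x x us "ys @ vs"] Cons.prems(2) by (simp add: pair_coeff_def)
    next
      case 3
      then show ?thesis
        using swap[of y x us "ys @ vs"] Cons.IH[of "us @ [y]"] Cons.prems
        by (simp add: smul_smul)
    qed
  qed
  have "prod_mset (mset (map (pair_coeff q x) (sort r))) = prod_mset (mset (map (pair_coeff q x) r))"
    by (simp only: mset_map mset_sort)
  then have "prod_list (map (pair_coeff q x) (sort r)) = prod_list (map (pair_coeff q x) r)"
    by (simp only: prod_mset_prod_list)
  then show ?case
    using Cons.IH[of "us @ [x]"] insert[of "sort r" us] Cons.prems
    by (simp add: smul_smul mult.commute)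
qed

lemma word_coeff_sort_block:
  "word_coeff q (us @ s @ vs) = word_coeff q s * word_coeff q (us @ sort s @ vs)"
  by (rule alternating_sort[where X = UNIV and smul = "(*)"]) (auto simp: word_coeff_swap)

section \<open>Determinants with an arbitrary word of rows\<close>

definition word_prod :: "(nat \<Rightarrow> nat \<Rightarrow> 'a::complex_unital_algebra) \<Rightarrow> nat list \<Rightarrow> nat list \<Rightarrow> 'a" where
  "word_prod a r s = prod_list (map2 a r s)"

lemma word_prod_simps [simp]:
  "word_prod a [] s = 1"
  "word_prod a (x # r) (y # s) = a x y * word_prod a r s"
  by (simp_all add: word_prod_def)

lemma word_prod_append:
  "length r = length s \<Longrightarrow> word_prod a (r @ r') (s @ s') = word_prod a r s * word_prod a r' s'"
  by (simp add: word_prod_def)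

text \<open>
  The columns range over all words in \<open>{..<N}\<close>, whatever the length of \<open>r\<close>; for length \<open>N\<close> only the
  permutations of \<open>{..<N}\<close> contribute.
\<close>

definition row_det ::
    "nat \<Rightarrow> (nat \<Rightarrow> nat \<Rightarrow> complex) \<Rightarrow> (nat \<Rightarrow> nat \<Rightarrow> 'a::complex_unital_algebra) \<Rightarrow> nat list \<Rightarrow> 'a" where
  "row_det N q a r =
     (\<Sum>s\<in>words {..<N} (length r). word_coeff q s *\<^sub>C word_prod a r s)"

text \<open>
  The column words that agree outside the two positions in question form pairs \<open>k l\<close>, \<open>l k\<close> with \<open>k < l\<close>, whose
  coefficients differ by the factor \<open>- q k l\<close>. Summing over such a pair leaves a quadratic expression in
  the entries that the defining relations of the matrix allow to rewrite with the rows exchanged.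
\<close>

lemma row_det_swap:
  fixes a :: "nat \<Rightarrow> nat \<Rightarrow> 'a::complex_unital_algebra"
  assumes pl: "pl_condition N p q" "pl_matrix N p q a"
    and xy: "y \<le> x" "x < N"
  shows "row_det N q a (us @ x # y # vs) = pair_coeff q x y *\<^sub>C row_det N q a (us @ y # x # vs)"
proof -
  let ?W = "words {..<N}"
  define g where "g x y s t k l =
    word_coeff q (s @ k # l # t) *\<^sub>C (word_prod a us s * (a x k * a y l) * word_prod a vs t)"
    for x y s t k l
  have expand: "row_det N q a (us @ x # y # vs) =
      (\<Sum>s\<in>?W (length us). \<Sum>t\<in>?W (length vs). \<Sum>k<N. \<Sum>l<N. g x y s t k l)" for x y
  proof -
    have len: "length (us @ x # y # vs) = length us + Suc (Suc (length vs))" by simp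
    have "row_det N q a (us @ x # y # vs) =
        (\<Sum>s\<in>?W (length us). \<Sum>k<N. \<Sum>l<N. \<Sum>t\<in>?W (length vs). g x y s t k l)"
      unfolding row_det_def len sum_words_append sum_words_Suc g_def
      by (intro sum.cong refl) (auto simp: words_def word_prod_append mult.assoc)
    also have "\<dots> = (\<Sum>s\<in>?W (length us). \<Sum>t\<in>?W (length vs). \<Sum>k<N. \<Sum>l<N. g x y s t k l)"
      by (simp add: sum.swap[of _ "?W (length vs)"])
    finally show ?thesis .
  qed
  have "(\<Sum>k<N. \<Sum>l<N. g x y s t k l) = (\<Sum>k<N. \<Sum>l<N. pair_coeff q x y *\<^sub>C g y x s t k l)"
    for s t
  proof (rule sum_symmetrize)
    fix k
    show "g x y s t k k = pair_coeff q x y *\<^sub>C g y x s t k k"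
      by (simp add: g_def word_coeff_eq_0)
  next
    fix k l assume kl: "k < l" "l < N"
    let ?c = "word_coeff q (s @ k # l # t)"
    let ?P = "word_prod a us s" and ?Q = "word_prod a vs t"
    have c: "word_coeff q (s @ l # k # t) = - q k l * ?c"
      using kl word_coeff_swap[of k l q s t] by (simp add: pair_coeff_def)
    have g_pair: "g x y s t k l + g x y s t l k =
        ?c *\<^sub>C (?P * (a x k * a y l - q k l *\<^sub>C (a x l * a y k)) * ?Q)" for x y
      by (simp add: g_def c algebra_simps mult_scaleC_left mult_scaleC_right scaleC_scaleC
          scaleC_diff_right scaleC_minus_left)
    have rel: "a x k * a y l - q k l *\<^sub>C (a x l * a y k) =
        pair_coeff q x y *\<^sub>C (a y k * a x l - q k l *\<^sub>C (a y l * a x k))"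
    proof (cases "x = y")
      case True
      then have "a x k * a y l = q k l *\<^sub>C (a x l * a y k)"
        using pl(2) xy kl by (simp add: pl_matrix_def)
      with True show ?thesis by (simp add: pair_coeff_def)
    next
      case False
      with xy have "y < x" by simp
      then have nz: "q y x \<noteq> 0"
        using pl(1) xy unfolding pl_condition_def by (metis less_trans mult_zero_left zero_neq_one)
      have "a y k * a x l - (q k l / q y x) *\<^sub>C (a x l * a y k) =
          q k l *\<^sub>C (a y l * a x k) - (1 / q y x) *\<^sub>C (a x k * a y l)"
        using pl(2) \<open>y < x\<close> xy kl unfolding pl_matrix_def by blast
      \<comment> \<open>The right-hand side is \<open>- 1 / q y x\<close> times the left-hand side with \<open>x\<close> and \<open>y\<close> exchanged.\<close>
      then have "a y k * a x l - q k l *\<^sub>C (a y l * a x k) =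
          (q k l / q y x) *\<^sub>C (a x l * a y k) - (1 / q y x) *\<^sub>C (a x k * a y l)"
        by (simp add: algebra_simps)
      then show ?thesis
        using \<open>y < x\<close> nz
        by (simp add: pair_coeff_def scaleC_diff_right scaleC_scaleC scaleC_minus_left scaleC_one)
    qed
    show "g x y s t k l + g x y s t l k =
        pair_coeff q x y *\<^sub>C g y x s t k l + pair_coeff q x y *\<^sub>C g y x s t l k"
      unfolding scaleC_add_right[symmetric] g_pair rel
      by (simp add: mult_scaleC_left mult_scaleC_right scaleC_scaleC mult.commute)
  qed
  then show ?thesis
    unfolding expand by (simp add: scaleC_sum_right)
qed

lemma sort_eq_upt:
  assumes "s \<in> words {..<N} N" "distinct s"
  shows "sort s = [0..<N]"
proof (rule sorted_distinct_set_unique)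
  have "card (set s) = N"
    using assms by (simp add: words_def distinct_card)
  then have "set s = {..<N}"
    using assms by (intro card_subset_eq) (auto simp: words_def)
  then show "set (sort s) = set [0..<N]"
    by (simp add: atLeast0LessThan)
  show "distinct (sort s)"
    using assms(2) by simp
qed simp_all

text \<open>
  Sorting \<open>r\<close> gives \<open>[0..<N]\<close> if \<open>r\<close> is a permutation, and otherwise both sides vanish with the coefficient.
\<close>

lemma row_det_eq:
  assumes "pl_condition N p q" "pl_matrix N p q a" "r \<in> words {..<N} N"
  shows "row_det N q a r = word_coeff q r *\<^sub>C row_det N q a [0..<N]"
proof -
  have "row_det N q a ([] @ r @ []) = word_coeff q r *\<^sub>C row_det N q a ([] @ sort r @ [])"
    by (rule alternating_sort[where X = "{..<N}"])
      (use assms in \<open>auto simp: scaleC_one scaleC_scaleC words_def intro!: row_det_swap\<close>)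
  then show ?thesis
    using sort_eq_upt[OF assms(3)] word_coeff_eq_0[of r q] by (cases "distinct r") auto
qed

section \<open>Minors as sums over words\<close>

lemma q_minor_eq:
  assumes I: "I \<in> increasing_tuples t N" and J: "length J = t"
  shows "q_minor q a J I =
    (\<Sum>s | s \<in> words {..<N} t \<and> sort s = I. word_coeff q s *\<^sub>C word_prod a J s)"
proof -
  have len: "length I = t" and inc: "sorted_wrt (<) I" and sub: "set I \<subseteq> {..<N}"
    using I by (auto simp: increasing_tuples_def)
  have sd: "sorted I" "distinct I"
    using inc by (auto simp: strict_sorted_iff)
  have "bij_betw (\<lambda>\<sigma>. permute_list \<sigma> I) {\<sigma>. \<sigma> permutes {..<t}}
      {s. s \<in> words {..<N} t \<and> sort s = I}"
    unfolding bij_betw_def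
  proof
    show "inj_on (\<lambda>\<sigma>. permute_list \<sigma> I) {\<sigma>. \<sigma> permutes {..<t}}"
    proof (rule inj_onI)
      fix \<sigma> \<tau> assume "\<sigma> \<in> {\<sigma>. \<sigma> permutes {..<t}}" "\<tau> \<in> {\<sigma>. \<sigma> permutes {..<t}}"
        and eq: "permute_list \<sigma> I = permute_list \<tau> I"
      then have perm: "\<sigma> permutes {..<t}" "\<tau> permutes {..<t}" by blast+
      show "\<sigma> = \<tau>"
      proof
        fix k
        show "\<sigma> k = \<tau> k"
        proof (cases "k < t")
          case True
          have "permute_list \<sigma> I ! k = I ! \<sigma> k" "permute_list \<tau> I ! k = I ! \<tau> k"
            by (rule permute_list_nth; use perm len True in simp)+
          moreover have "\<sigma> k < t" "\<tau> k < t"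
            using True permutes_in_image[OF perm(1), of k] permutes_in_image[OF perm(2), of k]
            by simp_all
          ultimately show ?thesis
            using sd(2) len eq nth_eq_iff_index_eq[of I "\<sigma> k" "\<tau> k"] by simp
        next
          case False
          then show ?thesis
            using permutes_not_in[OF perm(1), of k] permutes_not_in[OF perm(2), of k] by simp
        qed
      qed
    qed
    show "(\<lambda>\<sigma>. permute_list \<sigma> I) ` {\<sigma>. \<sigma> permutes {..<t}} =
        {s. s \<in> words {..<N} t \<and> sort s = I}"
    proof (intro equalityI subsetI)
      fix s assume "s \<in> (\<lambda>\<sigma>. permute_list \<sigma> I) ` {\<sigma>. \<sigma> permutes {..<t}}"
      then have mset: "mset I = mset s"
        using len by auto
      have "sort s = I"
        using mset sd(1) by (rule properties_for_sort)
      moreover have "set s = set I" "length s = length I"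
        using mset by (metis mset_eq_setD, metis mset_eq_length)
      ultimately show "s \<in> {s. s \<in> words {..<N} t \<and> sort s = I}"
        using len sub by (simp add: words_def)
    next
      fix s assume "s \<in> {s. s \<in> words {..<N} t \<and> sort s = I}"
      then have "mset (sort s) = mset I"
        by simp
      then have "mset s = mset I"
        by (simp only: mset_sort)
      then obtain \<sigma> where "\<sigma> permutes {..<length I}" "permute_list \<sigma> I = s"
        by (rule mset_eq_permutation)
      then show "s \<in> (\<lambda>\<sigma>. permute_list \<sigma> I) ` {\<sigma>. \<sigma> permutes {..<t}}"
        using len by auto
    qed
  qed
  then have "(\<Sum>s | s \<in> words {..<N} t \<and> sort s = I. word_coeff q s *\<^sub>C word_prod a J s) =
      (\<Sum>\<sigma> | \<sigma> permutes {..<t}.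
        word_coeff q (permute_list \<sigma> I) *\<^sub>C word_prod a J (permute_list \<sigma> I))"
    by (rule sum.reindex_bij_betw[symmetric])
  also have "\<dots> = q_minor q a J I"
    unfolding q_minor_def len
  proof (rule sum.cong[OF refl])
    fix \<sigma> assume "\<sigma> \<in> {\<sigma>. \<sigma> permutes {..<t}}"
    then have "neg_q t (\<lambda>r s. q (I ! r) (I ! s)) \<sigma> = word_coeff q (permute_list \<sigma> I)"
      using neg_q_eq_word_coeff[of \<sigma> I q] inc len by simp
    moreover have "map2 a J (permute_list \<sigma> I) = map (\<lambda>k. a (J ! k) (I ! \<sigma> k)) [0..<t]"
      using J len by (intro nth_equalityI) (auto simp: permute_list_def)
    ultimately show "word_coeff q (permute_list \<sigma> I) *\<^sub>C word_prod a J (permute_list \<sigma> I) =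
        neg_q t (\<lambda>r s. q (I ! r) (I ! s)) \<sigma> *\<^sub>C
          prod_list (map (\<lambda>k. a (J ! k) (I ! \<sigma> k)) [0..<t])"
      by (simp add: word_prod_def)
  qed
  finally show ?thesis by (rule sym)
qed

lemma q_det_eq_row_det: "q_det N q a = row_det N q a [0..<N]"
proof -
  have "q_det N q a =
      (\<Sum>s | s \<in> words {..<N} N \<and> sort s = [0..<N]. word_coeff q s *\<^sub>C word_prod a [0..<N] s)"
    unfolding q_det_def by (rule q_minor_eq) (auto simp: increasing_tuples_def)
  also have "\<dots> = row_det N q a [0..<N]"
    unfolding row_det_def
  proof (rule sum.mono_neutral_left)
    show "\<forall>s\<in>words {..<N} (length [0..<N]) - {s. s \<in> words {..<N} N \<and> sort s = [0..<N]}.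
        word_coeff q s *\<^sub>C word_prod a [0..<N] s = 0"
    proof
      fix s
      assume "s \<in> words {..<N} (length [0..<N]) - {s. s \<in> words {..<N} N \<and> sort s = [0..<N]}"
      then have "\<not> distinct s"
        using sort_eq_upt[of s N] by auto
      then show "word_coeff q s *\<^sub>C word_prod a [0..<N] s = 0"
        by (simp add: word_coeff_eq_0)
    qed
  qed auto
  finally show ?thesis .
qed

section \<open>Laplace expansion along blocks of rows\<close>

lemma finite_increasing_tuples [simp]: "finite (increasing_tuples t N)"
  by (rule finite_subset[OF _ finite_words[of "{..<N}" t]])
    (auto simp: increasing_tuples_def words_def)

lemma sum_words_by_sorting:
  assumes "\<And>s. \<not> distinct s \<Longrightarrow> f s = 0"
  shows "sum f (words {..<N} t) =
    (\<Sum>I\<in>increasing_tuples t N. \<Sum>s | s \<in> words {..<N} t \<and> sort s = I. f s)"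
proof -
  have "sum f (words {..<N} t) = sum f {s \<in> words {..<N} t. distinct s}"
    using assms by (intro sum.mono_neutral_right) auto
  also have "\<dots> = (\<Sum>I\<in>increasing_tuples t N.
      \<Sum>s | s \<in> {s \<in> words {..<N} t. distinct s} \<and> sort s = I. f s)"
  proof (rule sum.group[symmetric])
    show "sort ` {s \<in> words {..<N} t. distinct s} \<subseteq> increasing_tuples t N"
      by (auto simp: increasing_tuples_def words_def strict_sorted_iff)
  qed simp_all
  also have "\<dots> = (\<Sum>I\<in>increasing_tuples t N. \<Sum>s | s \<in> words {..<N} t \<and> sort s = I. f s)"
    using assms by (intro sum.cong refl sum.mono_neutral_left) auto
  finally show ?thesis .
qed

text \<open>
  Induction on the number of blocks. The words \<open>s\<close> of column indices for the first block are grouped by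
  \<open>I = sort s\<close>; by \<open>word_coeff_sort_block\<close>, replacing \<open>s\<close> by \<open>I\<close> splits off the factor \<open>word_coeff q s\<close>, and the
  sum over \<open>s\<close> becomes the minor with columns \<open>I\<close>. The prefix \<open>us\<close> carries the columns of the
  blocks already treated, whose letters interact with the later ones.
\<close>

lemma laplace_expansion:
  assumes "\<And>J. J \<in> set Js \<Longrightarrow> length J = m"
  shows "(\<Sum>s\<in>words {..<N} (length (concat Js)).
      word_coeff q (us @ s) *\<^sub>C word_prod a (concat Js) s) =
    (\<Sum>Is\<in>words (increasing_tuples m N) (length Js).
      word_coeff q (us @ concat Is) *\<^sub>C prod_list (map2 (q_minor q a) Js Is))"
  using assms
proof (induction Js arbitrary: us)
  case Nil
  then show ?case by simp
next
  case (Cons J Js)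
  let ?W = "words {..<N}" and ?T = "words (increasing_tuples m N) (length Js)"
  let ?l = "length (concat Js)"
  define F where "F s = (\<Sum>t\<in>?W ?l. word_coeff q (us @ s @ t) *\<^sub>C
    (word_prod a J s * word_prod a (concat Js) t))" for s
  have J: "length J = m" using Cons.prems by simp
  have block: "(\<Sum>s | s \<in> ?W m \<and> sort s = I. F s) =
      (\<Sum>Is\<in>?T. word_coeff q (us @ I @ concat Is) *\<^sub>C
        (q_minor q a J I * prod_list (map2 (q_minor q a) Js Is)))"
    if I: "I \<in> increasing_tuples m N" for I
  proof -
    have "F s = (word_coeff q s *\<^sub>C word_prod a J s) *
        (\<Sum>Is\<in>?T. word_coeff q ((us @ I) @ concat Is) *\<^sub>C prod_list (map2 (q_minor q a) Js Is))"
      if "sort s = I" for s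
    proof -
      have "F s = (word_coeff q s *\<^sub>C word_prod a J s) *
          (\<Sum>t\<in>?W ?l. word_coeff q ((us @ I) @ t) *\<^sub>C word_prod a (concat Js) t)"
        unfolding F_def word_coeff_sort_block[of q us s] that
        by (simp add: sum_distrib_left mult_scaleC_left mult_scaleC_right scaleC_scaleC
            mult.commute scaleC_sum_right)
      then show ?thesis
        using Cons.IH[of "us @ I"] Cons.prems by simp
    qed
    then have "(\<Sum>s | s \<in> ?W m \<and> sort s = I. F s) =
        (\<Sum>s | s \<in> ?W m \<and> sort s = I. word_coeff q s *\<^sub>C word_prod a J s) *
        (\<Sum>Is\<in>?T. word_coeff q ((us @ I) @ concat Is) *\<^sub>C prod_list (map2 (q_minor q a) Js Is))"
      by (simp add: sum_distrib_right)
    then show ?thesis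
      unfolding q_minor_eq[OF I J, symmetric]
      by (simp add: sum_distrib_left mult_scaleC_right)
  qed
  have "(\<Sum>s\<in>?W (length (concat (J # Js))).
      word_coeff q (us @ s) *\<^sub>C word_prod a (concat (J # Js)) s) = (\<Sum>s\<in>?W m. F s)"
    by (simp add: sum_words_append J F_def)
      (intro sum.cong refl, auto simp: words_def word_prod_append J)
  also have "\<dots> = (\<Sum>I\<in>increasing_tuples m N. \<Sum>s | s \<in> ?W m \<and> sort s = I. F s)"
    by (rule sum_words_by_sorting) (auto simp: F_def word_coeff_eq_0)
  also have "\<dots> = (\<Sum>Is\<in>words (increasing_tuples m N) (length (J # Js)).
      word_coeff q (us @ concat Is) *\<^sub>C prod_list (map2 (q_minor q a) (J # Js) Is))"
    by (simp add: sum_words_Suc block)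
  finally show ?case .
qed

section \<open>The hyper-Pfaffian as a sum over words\<close>

lemma length_concat_blocks:
  "(\<And>I. I \<in> set Is \<Longrightarrow> length I = m) \<Longrightarrow> length (concat Is) = m * length Is"
  by (induction Is) simp_all

lemma concat_blocks:
  "concat (map (\<lambda>k. map f [k * m..<Suc k * m]) [0..<n]) = map f [0..<m * n]"
proof (induction n)
  case (Suc n)
  have "[0..<m * Suc n] = [0..<m * n] @ [n * m..<Suc n * m]"
    using upt_add_eq_append[of 0 "m * n" m] by (simp add: mult.commute add.commute)
  with Suc show ?case by simp
qed simp

text \<open>
  A permutation that increases on each block corresponds to the list of its blocks, read as increasing
  tuples. The lists of tuples that arise in this way are those without a common letter in their
  concatenation, and all others have coefficient \<open>0\<close>.
\<close>

lemma q_hyper_pfaffian_eq: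
  "q_hyper_pfaffian m n q b =
    (\<Sum>Is\<in>words (increasing_tuples m (m * n)) n.
      word_coeff q (concat Is) *\<^sub>C prod_list (map b Is))"
proof -
  let ?N = "m * n"
  let ?T = "words (increasing_tuples m ?N) n"
  define \<Phi> where "\<Phi> \<sigma> = map (\<lambda>k. map \<sigma> [k * m..<Suc k * m]) [0..<n]" for \<sigma> :: "nat \<Rightarrow> nat"
  have concat_\<Phi>: "concat (\<Phi> \<sigma>) = map \<sigma> [0..<?N]" for \<sigma>
    unfolding \<Phi>_def by (rule concat_blocks)
  have lt: "i < ?N" if "k < n" "i < Suc k * m" for i k
  proof -
    have "Suc k * m \<le> n * m" using that(1) by (intro mult_le_mono1) simp
    with that(2) show ?thesis by (simp add: mult.commute)
  qed
  have increasing: "sorted_wrt (<) (map \<sigma> [k..<l]) \<longleftrightarrow> strict_mono_on {k..<l} \<sigma>"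
    for \<sigma> :: "nat \<Rightarrow> nat" and k l
  proof -
    have "sorted_wrt P [k..<l] \<longleftrightarrow> (\<forall>i\<in>{k..<l}. \<forall>j\<in>{k..<l}. i < j \<longrightarrow> P i j)" for P
      by (induction l) (auto simp: sorted_wrt_append less_Suc_eq)
    then show ?thesis
      by (auto simp: sorted_wrt_map strict_mono_on_def)
  qed
  have "bij_betw \<Phi> (block_increasing_perms m n) {Is \<in> ?T. distinct (concat Is)}"
    unfolding bij_betw_def
  proof
    show "inj_on \<Phi> (block_increasing_perms m n)"
    proof (rule inj_onI)
      fix \<sigma> \<tau> assume perm: "\<sigma> \<in> block_increasing_perms m n" "\<tau> \<in> block_increasing_perms m n"
        and "\<Phi> \<sigma> = \<Phi> \<tau>"
      then have eq: "map \<sigma> [0..<?N] = map \<tau> [0..<?N]"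
        by (metis concat_\<Phi>)
      have "\<sigma> k = \<tau> k" for k
        using perm eq by (cases "k < ?N") (auto simp: block_increasing_perms_def permutes_not_in)
      then show "\<sigma> = \<tau>" by blast
    qed
    show "\<Phi> ` block_increasing_perms m n = {Is \<in> ?T. distinct (concat Is)}"
    proof (intro equalityI subsetI)
      fix Is assume "Is \<in> \<Phi> ` block_increasing_perms m n"
      then obtain \<sigma> where Is: "Is = \<Phi> \<sigma>" and perm: "\<sigma> permutes {..<?N}"
        and mono: "\<And>k. k < n \<Longrightarrow> strict_mono_on {k * m..<Suc k * m} \<sigma>"
        by (auto simp: block_increasing_perms_def)
      have "distinct (concat Is)"
        unfolding Is concat_\<Phi> using permutes_inj_on[OF perm] by (simp add: distinct_map)
      moreover have "map \<sigma> [k * m..<Suc k * m] \<in> increasing_tuples m ?N" if "k < n" for k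
        using that mono[OF that] lt[OF that] permutes_in_image[OF perm]
        by (auto simp: increasing_tuples_def increasing simp del: mult_Suc) simp
      ultimately show "Is \<in> {Is \<in> ?T. distinct (concat Is)}"
        by (auto simp: Is \<Phi>_def words_def)
    next
      fix Is assume "Is \<in> {Is \<in> ?T. distinct (concat Is)}"
      then have d: "distinct (concat Is)" and len: "length Is = n"
        and inc: "\<And>I. I \<in> set Is \<Longrightarrow> I \<in> increasing_tuples m ?N"
        by (auto simp: words_def)
      have lens: "length I = m" if "I \<in> set Is" for I
        using inc[OF that] by (simp add: increasing_tuples_def)
      then have "length (concat Is) = ?N"
        using length_concat_blocks[of Is m] len by simp
      then have "concat Is \<in> words {..<?N} ?N"
        using inc by (fastforce simp: words_def increasing_tuples_def)
      then have "mset (concat Is) = mset [0..<?N]"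
        using sort_eq_upt[OF _ d] by (metis mset_sort)
      then obtain \<sigma> where perm: "\<sigma> permutes {..<?N}" and \<sigma>: "permute_list \<sigma> [0..<?N] = concat Is"
        by (metis mset_eq_permutation length_upt minus_nat.diff_0)
      have "map \<sigma> [0..<?N] = concat Is"
        unfolding \<sigma>[symmetric] permute_list_def
        using permutes_in_image[OF perm] by (intro map_cong) auto
      then have "concat (\<Phi> \<sigma>) = concat Is"
        by (simp add: concat_\<Phi>)
      then have eq: "\<Phi> \<sigma> = Is"
        by (rule concat_injective) (auto simp: \<Phi>_def len lens elim!: in_set_zipE)
      have "strict_mono_on {k * m..<Suc k * m} \<sigma>" if "k < n" for k
        using inc[of "\<Phi> \<sigma> ! k"] that len unfolding eq[symmetric]
        by (simp add: \<Phi>_def increasing_tuples_def increasing del: mult_Suc)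
      then show "Is \<in> \<Phi> ` block_increasing_perms m n"
        using perm eq by (auto simp: block_increasing_perms_def)
    qed
  qed
  then have "(\<Sum>Is | Is \<in> ?T \<and> distinct (concat Is).
        word_coeff q (concat Is) *\<^sub>C prod_list (map b Is)) =
      (\<Sum>\<sigma>\<in>block_increasing_perms m n.
        word_coeff q (concat (\<Phi> \<sigma>)) *\<^sub>C prod_list (map b (\<Phi> \<sigma>)))"
    by (rule sum.reindex_bij_betw[symmetric])
  also have "\<dots> = q_hyper_pfaffian m n q b"
    unfolding q_hyper_pfaffian_def
  proof (rule sum.cong[OF refl])
    fix \<sigma> assume "\<sigma> \<in> block_increasing_perms m n"
    then have perm: "\<sigma> permutes {..<?N}" by (simp add: block_increasing_perms_def)
    have lt: "\<sigma> k < ?N" if "k < ?N" for k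
      using permutes_in_image[OF perm] that by auto
    have "permute_list \<sigma> [0..<?N] = map \<sigma> [0..<?N]"
      unfolding permute_list_def using lt by (intro map_cong) auto
    moreover have "neg_q ?N q \<sigma> = neg_q ?N (\<lambda>r s. q ([0..<?N] ! r) ([0..<?N] ! s)) \<sigma>"
      unfolding neg_q_def using lt
      by (intro arg_cong2[where f = "(*)"] prod.cong) (auto simp: inversions_def)
    ultimately have "neg_q ?N q \<sigma> = word_coeff q (concat (\<Phi> \<sigma>))"
      using neg_q_eq_word_coeff[of \<sigma> "[0..<?N]" q] perm by (simp add: concat_\<Phi>)
    then show "word_coeff q (concat (\<Phi> \<sigma>)) *\<^sub>C prod_list (map b (\<Phi> \<sigma>)) =
        neg_q ?N q \<sigma> *\<^sub>C prod_list (map (\<lambda>k. b (map \<sigma> [k * m..<Suc k * m])) [0..<n])"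
      by (simp add: \<Phi>_def comp_def)
  qed
  finally have "q_hyper_pfaffian m n q b = (\<Sum>Is | Is \<in> ?T \<and> distinct (concat Is).
      word_coeff q (concat Is) *\<^sub>C prod_list (map b Is))" by simp
  also have "\<dots> = (\<Sum>Is\<in>?T. word_coeff q (concat Is) *\<^sub>C prod_list (map b Is))"
    by (rule sum.mono_neutral_left) (auto simp: word_coeff_eq_0)
  finally show ?thesis .
qed

section \<open>The hyper-Pfaffian of the transformed hypermatrix\<close>

lemma prod_list_map2_mult:
  fixes f :: "'b \<Rightarrow> 'c \<Rightarrow> 'a::monoid_mult"
  assumes "length js = length is"
    and "\<And>j j' i. j \<in> set js \<Longrightarrow> j' \<in> set js \<Longrightarrow> i \<in> set is \<Longrightarrow> g j * f j' i = f j' i * g j"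
  shows "prod_list (map2 (\<lambda>j i. f j i * g j) js is) =
    prod_list (map2 f js is) * prod_list (map g js)"
  using assms
proof (induction js "is" rule: list_induct2)
  case (Cons j js i "is")
  have comm: "g j * prod_list (map2 f js' is') = prod_list (map2 f js' is') * g j"
    if "set js' \<subseteq> set js" "set is' \<subseteq> set is" for js' is'
    using that
  proof (induction js' is' rule: list_induct2')
    case (4 j' js' i' is')
    then have "g j * f j' i' = f j' i' * g j"
      using Cons.prems by auto
    then have "g j * prod_list (map2 f (j' # js') (i' # is')) =
        f j' i' * (g j * prod_list (map2 f js' is'))"
      by (simp add: mult.assoc[symmetric])
    then show ?case
      using 4 by (simp add: mult.assoc)
  qed simp_all
  have "prod_list (map2 (\<lambda>j i. f j i * g j) js is) =
      prod_list (map2 f js is) * prod_list (map g js)"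
    using Cons.prems by (intro Cons.IH) auto
  then have "prod_list (map2 (\<lambda>j i. f j i * g j) (j # js) (i # is)) =
      f j i * ((g j * prod_list (map2 f js is)) * prod_list (map g js))"
    by (simp add: mult.assoc)
  also have "g j * prod_list (map2 f js is) = prod_list (map2 f js is) * g j"
    by (intro comm order_refl)
  finally show ?case
    by (simp add: mult.assoc)
qed simp

lemma commute_q_minor:
  fixes a :: "nat \<Rightarrow> nat \<Rightarrow> 'a::complex_unital_algebra"
  assumes "\<And>i k. i < N \<Longrightarrow> k < N \<Longrightarrow> x * a i k = a i k * x"
    and I: "I \<in> increasing_tuples t N" and J: "J \<in> increasing_tuples t N"
  shows "x * q_minor q a J I = q_minor q a J I * x"
proof -
  have "x * word_prod a r s = word_prod a r s * x"
    if "set r \<subseteq> {..<N}" "set s \<subseteq> {..<N}" for r s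
    using that
  proof (induction r s rule: list_induct2')
    case (4 i r k s)
    then have "x * a i k = a i k * x" using assms(1) by auto
    then have "x * word_prod a (i # r) (k # s) = a i k * (x * word_prod a r s)"
      by (simp add: mult.assoc[symmetric])
    then show ?case
      using 4 by (simp add: mult.assoc)
  qed (simp_all add: word_prod_def)
  moreover have "set J \<subseteq> {..<N}" "length J = t"
    using J by (auto simp: increasing_tuples_def)
  ultimately show ?thesis
    unfolding q_minor_eq[OF I \<open>length J = t\<close>] sum_distrib_left sum_distrib_right
    by (intro sum.cong) (auto simp: words_def mult_scaleC_left mult_scaleC_right)
qed

text \<open>
  The sums over the columns \<open>Is\<close> and over the rows \<open>Js\<close> range over the same set of \<open>n\<close>-tuples of increasing
  \<open>m\<close>-tuples. For fixed \<open>Js\<close>, the sum over \<open>Is\<close> is a Laplace expansion.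
\<close>

theorem theorem5p3:
  fixes m n :: nat
    and p q :: "nat \<Rightarrow> nat \<Rightarrow> complex"
    and A :: "nat \<Rightarrow> nat \<Rightarrow> 'r::complex_unital_algebra"
    and B C :: "nat list \<Rightarrow> 'r"
  assumes "m \<ge> 1" and "n \<ge> 1"
    and "pl_condition (m * n) p q"
    and "pl_matrix (m * n) p q A"
    and "\<And>J i k. length J = m \<Longrightarrow> set J \<subseteq> {..<m * n} \<Longrightarrow> i < m * n \<Longrightarrow> k < m * n \<Longrightarrow>
           B J * A i k = A i k * B J"
    and "\<And>I. I \<in> increasing_tuples m (m * n) \<Longrightarrow>
           C I = (\<Sum>J\<in>increasing_tuples m (m * n). q_minor q A J I * B J)"
  shows "q_hyper_pfaffian m n q C = q_det (m * n) q A * q_hyper_pfaffian m n q B"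
proof -
  let ?N = "m * n"
  let ?K = "increasing_tuples m ?N"
  let ?T = "words ?K n"
  let ?D = "row_det ?N q A"
  have prod_C: "prod_list (map C Is) =
      (\<Sum>Js\<in>?T. prod_list (map2 (q_minor q A) Js Is) * prod_list (map B Js))"
    if "Is \<in> ?T" for Is
  proof -
    have Is: "set Is \<subseteq> ?K" "length Is = n" using that by (auto simp: words_def)
    have "prod_list (map C Is) = prod_list (map (\<lambda>I. \<Sum>J\<in>?K. q_minor q A J I * B J) Is)"
      using Is assms(6) by (intro arg_cong[where f = prod_list] map_cong) auto
    also have "\<dots> = (\<Sum>Js\<in>?T. prod_list (map2 (\<lambda>J I. q_minor q A J I * B J) Js Is))"
      by (simp add: prod_list_sum Is)
    also have "\<dots> = (\<Sum>Js\<in>?T. prod_list (map2 (q_minor q A) Js Is) * prod_list (map B Js))"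
    proof (intro sum.cong refl prod_list_map2_mult)
      fix Js J J' I
      assume "Js \<in> ?T" "J \<in> set Js" "J' \<in> set Js" "I \<in> set Is"
      then have "J \<in> ?K" "J' \<in> ?K" "I \<in> ?K" using Is by (auto simp: words_def)
      then show "B J * q_minor q A J' I = q_minor q A J' I * B J"
        using assms(5) by (intro commute_q_minor[where N = ?N and t = m])
          (simp_all add: increasing_tuples_def)
    qed (simp add: words_def Is)
    finally show ?thesis .
  qed
  have laplace: "(\<Sum>Is\<in>?T. word_coeff q (concat Is) *\<^sub>C prod_list (map2 (q_minor q A) Js Is)) =
      word_coeff q (concat Js) *\<^sub>C q_det ?N q A" if "Js \<in> ?T" for Js
  proof -
    have Js: "length Js = n" "\<And>J. J \<in> set Js \<Longrightarrow> length J = m"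
      "\<And>J. J \<in> set Js \<Longrightarrow> set J \<subseteq> {..<?N}"
      using that by (auto simp: words_def increasing_tuples_def)
    then have "concat Js \<in> words {..<?N} ?N"
      using length_concat_blocks[of Js m] by (auto simp: words_def)
    then have "?D (concat Js) = word_coeff q (concat Js) *\<^sub>C q_det ?N q A"
      unfolding q_det_eq_row_det by (intro row_det_eq[OF assms(3,4)])
    then show ?thesis
      using laplace_expansion[where Js = Js and m = m and N = ?N and us = "[]" and q = q and a = A] Js by (simp add: row_det_def)
  qed
  have "q_hyper_pfaffian m n q C = (\<Sum>Is\<in>?T. \<Sum>Js\<in>?T.
      (word_coeff q (concat Is) *\<^sub>C prod_list (map2 (q_minor q A) Js Is)) * prod_list (map B Js))"
    unfolding q_hyper_pfaffian_eq
    by (intro sum.cong refl) (simp add: prod_C scaleC_sum_right mult_scaleC_left)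
  also have "\<dots> = (\<Sum>Js\<in>?T. (\<Sum>Is\<in>?T.
      word_coeff q (concat Is) *\<^sub>C prod_list (map2 (q_minor q A) Js Is)) * prod_list (map B Js))"
    by (subst sum.swap) (simp add: sum_distrib_right)
  also have "\<dots> = (\<Sum>Js\<in>?T. q_det ?N q A * (word_coeff q (concat Js) *\<^sub>C prod_list (map B Js)))"
    by (intro sum.cong refl) (simp add: laplace mult_scaleC_left mult_scaleC_right)
  also have "\<dots> = q_det ?N q A * q_hyper_pfaffian m n q B"
    unfolding q_hyper_pfaffian_eq by (simp add: sum_distrib_left)
  finally show ?thesis .
qed

end
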